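(* Assume that the feature dimension $d$ is no smaller than the number of classes $K$, i.e. $d\ge K$, and that the number of training samples in each class is balanced (equal to $n$ for each of the $K$ classes). Then any global minimizer $(\boldsymbol W^\star,\boldsymbol H^\star,\boldsymbol b^\star)$ of $f(\boldsymbol W,\boldsymbol H,\boldsymbol b)$ over $\mathbb R^{K\times d}\times\mathbb R^{d\times N}\times\mathbb R^K$ satisfies $$w^\star:=\|\boldsymbol w^{\star 1}\|_2=\|\boldsymbol w^{\star 2}\|_2=\cdots=\|\boldsymbol w^{\star K}\|_2,\qquad \boldsymbol b^\star=b^\star\boldsymbol 1\ \text{ (with } b^\star\in\mathbb R),$$ $$\boldsymbol h^\star_{k,i}=\sqrt{\frac{\lambda_{\boldsymbol W}}{\lambda_{\boldsymbol H}\,n}}\;\boldsymbol w^{\star k}\quad\forall k\in[K],\ i\in[n],\qquad \overline{\boldsymbol h}^\star_i:=\frac1K\sum_{j=1}^K\boldsymbol h^\star_{j,i}=\boldsymbol 0\quad\forall i\in[n],$$ where either $b^\star=0$ or $\lambda_{\boldsymbol b}=0$, and the matrix $\boldsymbol W^{\star\top}\in\mathbb R^{d\times K}$ forms a $K$-Simplex ETF up to some scaling and rotation, in the sense that for any $\boldsymbol U\in\mathbb R^{d\times d}$ with $\boldsymbol U^\top\boldsymbol U=\boldsymbol I_d$, the normalized matrix $\boldsymbol M:=\frac{1}{w^\star}\boldsymbol U\boldsymbol W^{\star\top}$ satisfies $$\boldsymbol M^\top\boldsymbol M=\frac{K}{K-1}\Big(\boldsymbol I_K-\frac1K\boldsymbol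 1_K\boldsymbol 1_K^\top\Big).$$
   Context: Let $K\ge 2$ (number of classes), $n\ge1$ (samples per class), $d\ge 1$ (feature dimension) be integers, $N=nK$, and let $\lambda_{\boldsymbol W},\lambda_{\boldsymbol H}>0$, $\lambda_{\boldsymbol b}\ge 0$. Write $[m]=\{1,\dots,m\}$, $\boldsymbol I_m$ for the $m\times m$ identity matrix, and $\boldsymbol 1$ (or $\boldsymbol 1_K$) for the all-ones vector in $\mathbb R^K$. For $k\in[K]$ let $\boldsymbol y_k\in\mathbb R^K$ be the one-hot vector with $k$-th entry $1$. The cross-entropy loss of $\boldsymbol z\in\mathbb R^K$ with label $\boldsymbol y_k$ is $$\mathcal L_{\mathrm{CE}}(\boldsymbol z,\boldsymbol y_k)=-\log\left(\frac{\exp(z_k)}{\sum_{i=1}^K\exp(z_i)}\right).$$ For $\boldsymbol W\in\mathbb R^{K\times d}$ with rows $(\boldsymbol w^1)^\top,\dots,(\boldsymbol w^K)^\top$, $\boldsymbol H=[\boldsymbol h_{1,1}\ \cdots\ \boldsymbol h_{K,n}]\in\mathbb R^{d\times N}$ with columns $\boldsymbol h_{k,i}\in\mathbb R^d$ ($k\in[K]$, $i\in[n]$), and $\boldsymbol b\in\mathbb R^K$, define $$f(\boldsymbol W,\boldsymbol H,\boldsymbol b)=\frac1{Kn}\sum_{k=1}^K\sum_{i=1}^n\mathcal L_{\mathrm{CE}}(\boldsymbol W\boldsymbol h_{k,i}+\boldsymbol b,\boldsymbol y_k)+\frac{\lambda_{\boldsymbol W}}2\|\boldsymbol W\|_F^2+\frac{\lambda_{\boldsymbol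 H}}2\|\boldsymbol H\|_F^2+\frac{\lambda_{\boldsymbol b}}2\|\boldsymbol b\|_2^2 .$$ A superscript $\star$ on $\boldsymbol w^{k}$, $\boldsymbol h_{k,i}$ refers to the rows of $\boldsymbol W^\star$ and the columns of $\boldsymbol H^\star$. A (general) $K$-Simplex ETF is the collection of points in $\mathbb R^d$ given by the columns of $\sqrt{\frac{K}{K-1}}\,\boldsymbol P(\boldsymbol I_K-\frac1K\boldsymbol 1_K\boldsymbol 1_K^\top)$ with $\boldsymbol P\in\mathbb R^{d\times K}$, $\boldsymbol P^\top\boldsymbol P=\boldsymbol I_K$.
   Formalization: The Gram identity for M is asserted only when w* ≠ 0: for strong regularization (e.g. K=2, n=1, d=2, all λ equal to 1) the global minimizer has W*=0, so M=(1/w* )UW*^T is undefined; all other conclusions hold unconditionally. *)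

theory Defs
  imports "HOL-Analysis.Analysis"
begin

(* Classes are indexed by 'k, the samples of one class by 'n and the features by 'd, so that
   K = CARD('k), n = CARD('n), d = CARD('d), and the N = n * K columns of H are indexed by
   pairs (k, i). *)

(* The second argument is the class k, standing for its one-hot label vector. *)
definition ce_loss :: "real ^ 'k \<Rightarrow> 'k::finite \<Rightarrow> real" where
  "ce_loss z k = - ln (exp (z $ k) / (\<Sum>i\<in>UNIV. exp (z $ i)))"

(* The norm of the type of matrices is the Frobenius norm. *)
definition ufm_objective ::
  "real \<Rightarrow> real \<Rightarrow> real \<Rightarrow>
   real ^ 'd ^ 'k \<Rightarrow> real ^ ('k::finite \<times> 'n::finite) ^ 'd \<Rightarrow> real ^ 'k \<Rightarrow> real" where
  "ufm_objective lW lH lb W H b =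
     1 / (real CARD('k) * real CARD('n)) *
       (\<Sum>k\<in>UNIV. \<Sum>i\<in>UNIV. ce_loss (W *v column (k, i) H + b) k)
     + lW / 2 * (norm W)\<^sup>2 + lH / 2 * (norm H)\<^sup>2 + lb / 2 * (norm b)\<^sup>2"

end

(* By Jensen's inequality the cross-entropy loss lies above its tangent at any logits for which the
   correct class leads all others by a gap t, and touches it only at such logits. The tangent is
   affine in \<Sum>j. z j - K z k, so the bias cancels when it is summed over the classes, and the
   remaining inner products <w k - wbar, h k i> are dominated by the regularisers via AM-GM. Hence
   the objective is a constant plus explicit nonnegative slacks, for every t whose tangent slope is
   at most n lH \<mu> = sqrt (n lW lH), where \<mu> = sqrt (lW / (lH n)). For a suitable
   t the constant is attained by a simplex ETF (or by zero), so at a minimizer all slacks vanish: this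
   aligns H with W, centres W, and prescribes the gaps, and the symmetry of the Gram matrix of the
   rows of W then forces the bias to be constant. *)

theory Submission
  imports Defs
begin

section \<open>Tangent bound for the cross-entropy loss\<close>

text \<open>Jensen's inequality with its equality case. With \<open>m\<close> the weighted mean, the
  nonnegative quantities \<open>g j\<close> measure the failure of \<open>exp x = 1 + x\<close> at
  \<open>x = u j - m\<close>. Their sum is \<open>S * exp (- m) - 1\<close>, and if it is zero, then
  every \<open>x\<close> is zero.\<close>

lemma sum_le_ln_sum_exp:
  fixes p u :: "'a \<Rightarrow> real"
  assumes "finite A" and p: "\<And>j. j \<in> A \<Longrightarrow> p j > 0" and p1: "(\<Sum>j\<in>A. p j) = 1"
  shows "(\<Sum>j\<in>A. p j * u j) \<le> ln (\<Sum>j\<in>A. p j * exp (u j))"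
    and "(\<Sum>j\<in>A. p j * u j) = ln (\<Sum>j\<in>A. p j * exp (u j)) \<Longrightarrow> i \<in> A \<Longrightarrow>
           u i = (\<Sum>j\<in>A. p j * u j)"
proof -
  define m where "m = (\<Sum>j\<in>A. p j * u j)"
  define S where "S = (\<Sum>j\<in>A. p j * exp (u j))"
  define g where "g j = p j * (exp (u j - m) - (1 + (u j - m)))" for j
  have g0: "g j \<ge> 0" if "j \<in> A" for j
    using p[OF that] exp_ge_add_one_self[of "u j - m"] by (auto simp: g_def)
  have "(\<Sum>j\<in>A. g j) = (\<Sum>j\<in>A. p j * exp (u j) * exp (- m)) - (\<Sum>j\<in>A. p j * (1 - m)) - (\<Sum>j\<in>A. p j * u j)"
    unfolding sum_subtractf[symmetric] g_def
    by (intro sum.cong refl) (simp add: algebra_simps exp_diff exp_minus divide_inverse)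
  also have "\<dots> = S * exp (- m) - 1"
    by (simp add: sum_distrib_right[symmetric] p1 S_def m_def)
  finally have gs: "(\<Sum>j\<in>A. g j) = S * exp (- m) - 1" .
  have "(\<Sum>j\<in>A. g j) \<ge> 0" using g0 by (rule sum_nonneg)
  hence "exp m \<le> S" using gs by (simp add: exp_minus field_simps)
  thus "m \<le> ln S" by (simp add: ln_ge_iff order.strict_trans2[OF exp_gt_zero])
  assume "m = ln S" and i: "i \<in> A"
  hence "S = exp m" using \<open>exp m \<le> S\<close> order.strict_trans2[OF exp_gt_zero] by simp
  hence "(\<Sum>j\<in>A. g j) = 0" using gs by (simp add: exp_minus)
  hence "g i = 0" using sum_nonneg_eq_0_iff[of A g] g0 i assms(1) by auto
  hence "exp (u i - m) = 1 + (u i - m)" using p[OF i] by (auto simp: g_def)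
  moreover have "ln (exp (u i - m)) = u i - m" by (rule ln_exp)
  ultimately show "u i = m"
    using ln_eq_minus_one[of "exp (u i - m)"] exp_gt_zero[of "u i - m"] by simp
qed

text \<open>Slope and intercept of the tangent at the logits that are \<open>t\<close> at the correct class and \<open>0\<close>
  elsewhere; \<open>gap_weight\<close> is the softmax probability of a wrong class.\<close>

definition gap_weight :: "real \<Rightarrow> real \<Rightarrow> real" where
  "gap_weight K t = 1 / (exp t + K - 1)"

definition gap_loss :: "real \<Rightarrow> real \<Rightarrow> real" where
  "gap_loss K t = ln (exp t + K - 1) - t + (K - 1) * t * gap_weight K t"

text \<open>The loss minus its tangent. Writing the gradient part as a full sum minus
  \<open>CARD('k) * z $ k\<close> is what lets the bias cancel on summing over
  \<open>k\<close>.\<close>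

definition ce_slack :: "real \<Rightarrow> real ^ 'k \<Rightarrow> 'k::finite \<Rightarrow> real" where
  "ce_slack t z k = ce_loss z k - gap_loss CARD('k) t
     - gap_weight CARD('k) t * ((\<Sum>j\<in>UNIV. z $ j) - CARD('k) * z $ k)"

lemma card_ge_1: "real CARD('k::finite) \<ge> 1"
  using zero_less_card_finite[where 'a='k] by simp

lemma gap_denom_pos: "exp t + real CARD('k::finite) - 1 > 0"
  using card_ge_1[where 'k='k] exp_gt_zero[of t] by linarith

lemma gap_weight_pos: "gap_weight (real CARD('k::finite)) t > 0"
  using gap_denom_pos[where 'k='k] by (simp add: gap_weight_def)

text \<open>The slack is exactly the gap in Jensen's inequality, with weights \<open>p\<close> the
  softmax at the tangent point and \<open>u\<close> the displacement of the logits from that point.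
  Equality means that \<open>u\<close> is constant.\<close>

lemma
  fixes z :: "real ^ 'k::finite"
  shows ce_slack_nonneg: "ce_slack t z k \<ge> 0"
    and ce_slack_eq_0_iff: "ce_slack t z k = 0 \<longleftrightarrow> (\<forall>j. j \<noteq> k \<longrightarrow> z $ k - z $ j = t)"
proof -
  define K where "K = real CARD('k)"
  define D where "D = exp t + K - 1"
  \<comment> \<open>Writing the entry at \<open>k\<close> as a correction to the constant value lets
    the sums over \<open>j\<close> split into a uniform part and a single term.\<close>
  define p where "p j = (1 + (if j = k then exp t - 1 else 0)) / D" for j
  define u where "u j = z $ j - (if j = k then t else 0)" for j
  have D: "D > 0" using gap_denom_pos[where 'k='k] by (simp add: D_def K_def)
  have p: "p j > 0" for j using D by (simp add: p_def)
  have p1: "(\<Sum>j\<in>UNIV. p j) = 1"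
    using D by (simp add: p_def sum_divide_distrib[symmetric] sum.distrib D_def K_def)
  have "p j * exp (u j) = exp (z $ j) / D" for j
    by (simp add: p_def u_def exp_diff)
  hence S: "(\<Sum>j\<in>UNIV. p j * exp (u j)) = (\<Sum>j\<in>UNIV. exp (z $ j)) / D"
    by (simp add: sum_divide_distrib)
  have Z: "(\<Sum>j\<in>UNIV. exp (z $ j)) > 0" by (rule sum_pos) auto
  have "p j * u j = (z $ j + (if j = k then (exp t - 1) * z $ j - t * exp t else 0)) / D" for j
    by (simp add: p_def u_def algebra_simps)
  hence pu: "(\<Sum>j\<in>UNIV. p j * u j) = ((\<Sum>j\<in>UNIV. z $ j) + (exp t - 1) * z $ k - t * exp t) / D"
    by (simp add: sum_divide_distrib[symmetric] sum.distrib)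
  have "ce_loss z k = ln (\<Sum>j\<in>UNIV. exp (z $ j)) - z $ k"
    using Z by (simp add: ce_loss_def ln_div)
  moreover have "ln ((\<Sum>j\<in>UNIV. exp (z $ j)) / D) = ln (\<Sum>j\<in>UNIV. exp (z $ j)) - ln D"
    using Z D by (simp add: ln_div)
  \<comment> \<open>Over the common denominator \<open>D\<close>, the affine part of the slack turns
    out to be the weighted mean of \<open>u\<close> computed in \<open>pu\<close>.\<close>
  moreover have "z $ k = (D * z $ k) / D" "t = (D * t) / D" using D by simp_all
  hence "z $ k - t + (K - 1) * t / D + ((\<Sum>j\<in>UNIV. z $ j) - K * z $ k) / D
      = (D * z $ k - D * t + (K - 1) * t + ((\<Sum>j\<in>UNIV. z $ j) - K * z $ k)) / D"
    by (metis (no_types, lifting) add_divide_distrib diff_divide_distrib)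
  moreover have "D * z $ k - D * t + (K - 1) * t + ((\<Sum>j\<in>UNIV. z $ j) - K * z $ k)
      = (\<Sum>j\<in>UNIV. z $ j) + (exp t - 1) * z $ k - t * exp t"
    by (simp add: D_def algebra_simps)
  ultimately have slack: "ce_slack t z k = ln (\<Sum>j\<in>UNIV. p j * exp (u j)) - (\<Sum>j\<in>UNIV. p j * u j)"
    unfolding S pu ce_slack_def gap_loss_def gap_weight_def K_def[symmetric] D_def[symmetric]
    by simp
  show "ce_slack t z k \<ge> 0"
    using sum_le_ln_sum_exp(1)[of UNIV p u] p p1 slack by simp
  show "ce_slack t z k = 0 \<longleftrightarrow> (\<forall>j. j \<noteq> k \<longrightarrow> z $ k - z $ j = t)"
  proof
    assume "ce_slack t z k = 0"
    hence *: "u i = (\<Sum>j\<in>UNIV. p j * u j)" for i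
      using sum_le_ln_sum_exp(2)[of UNIV p u i] p p1 slack by simp
    have "u k = u j" for j
      using *[of k] *[of j] by simp
    thus "\<forall>j. j \<noteq> k \<longrightarrow> z $ k - z $ j = t"
      unfolding u_def by (smt (verit))
  next
    assume "\<forall>j. j \<noteq> k \<longrightarrow> z $ k - z $ j = t"
    hence "u j = z $ k - t" for j unfolding u_def by (smt (verit))
    thus "ce_slack t z k = 0"
      using slack p1 by (simp add: sum_distrib_right[symmetric])
  qed
qed

section \<open>Frobenius norms and centring\<close>

lemma norm_matrix_rows: "(norm (A :: real ^ 'm ^ 'l))\<^sup>2 = (\<Sum>k\<in>UNIV. (norm (row k A))\<^sup>2)"
  by (simp add: norm_vec_def L2_set_def sum_nonneg row_def)

lemma norm_matrix_columns: "(norm (A :: real ^ 'm ^ 'l))\<^sup>2 = (\<Sum>k\<in>UNIV. (norm (column k A))\<^sup>2)"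
  unfolding norm_vec_def L2_set_def
  by (simp add: sum_nonneg column_def) (rule sum.swap)

lemma matrix_vector_mult_eq_inner_row: "(A *v x) $ j = row j A \<bullet> (x :: real ^ 'm)"
  by (simp add: matrix_vector_mult_def row_def inner_vec_def)

lemma
  fixes w :: "'k::finite \<Rightarrow> 'a::real_inner"
  defines "wbar \<equiv> (1 / real CARD('k)) *\<^sub>R (\<Sum>j\<in>UNIV. w j)"
  shows sum_centered: "(\<Sum>k\<in>UNIV. w k - wbar) = 0"
    and sum_norm_centered: "(\<Sum>k\<in>UNIV. (norm (w k - wbar))\<^sup>2)
      = (\<Sum>k\<in>UNIV. (norm (w k))\<^sup>2) - CARD('k) * (norm wbar)\<^sup>2"
proof -
  have s: "(\<Sum>j\<in>UNIV. w j) = real CARD('k) *\<^sub>R wbar" by (simp add: wbar_def)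
  show "(\<Sum>k\<in>UNIV. w k - wbar) = 0"
    by (simp add: sum_subtractf s sum_constant_scaleR)
  have "(\<Sum>k\<in>UNIV. (norm (w k - wbar))\<^sup>2)
     = (\<Sum>k\<in>UNIV. (norm (w k))\<^sup>2 + (norm wbar)\<^sup>2 - 2 * (w k \<bullet> wbar))"
    by (simp add: power2_norm_eq_inner inner_diff_left inner_diff_right inner_commute algebra_simps)
  also have "\<dots> = (\<Sum>k\<in>UNIV. (norm (w k))\<^sup>2) + CARD('k) * (norm wbar)\<^sup>2 - 2 * ((\<Sum>k\<in>UNIV. w k) \<bullet> wbar)"
    by (simp add: sum_subtractf sum.distrib sum_distrib_left inner_sum_left)
  finally show "(\<Sum>k\<in>UNIV. (norm (w k - wbar))\<^sup>2)
      = (\<Sum>k\<in>UNIV. (norm (w k))\<^sup>2) - CARD('k) * (norm wbar)\<^sup>2"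
    by (simp add: s power2_norm_eq_inner)
qed

section \<open>The objective as a constant plus slacks\<close>

lemma ufm_objective_eq:
  fixes lW lH lb t :: real
    and W :: "real ^ 'd ^ 'k" and H :: "real ^ ('k::finite \<times> 'n::finite) ^ 'd" and b :: "real ^ 'k"
  assumes "lW > 0" "lH > 0"
  defines "K \<equiv> real CARD('k)" and "n \<equiv> real CARD('n)"
  defines "\<mu> \<equiv> sqrt (lW / (lH * n))" and "q \<equiv> gap_weight K t"
    and "wbar \<equiv> (1 / K) *\<^sub>R (\<Sum>j\<in>UNIV. row j W)"
  shows "ufm_objective lW lH lb W H b = gap_loss K t
      + 1 / (K * n) * (\<Sum>k\<in>UNIV. \<Sum>i\<in>UNIV. ce_slack t (W *v column (k, i) H + b) k)
      + q / (2 * n * \<mu>) * (\<Sum>k\<in>UNIV. \<Sum>i\<in>UNIV. (norm (column (k, i) H - \<mu> *\<^sub>R (row k W - wbar)))\<^sup>2)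
      + q * \<mu> * K / 2 * (norm wbar)\<^sup>2
      + (1 - q / (n * lH * \<mu>)) * (lW / 2 * (norm W)\<^sup>2 + lH / 2 * (norm H)\<^sup>2)
      + lb / 2 * (norm b)\<^sup>2"
proof -
  have K: "K > 0" and n: "n > 0"
    using card_ge_1[where 'k='k] card_ge_1[where 'k='n] by (simp_all add: K_def n_def)
  have \<mu>: "\<mu> > 0" using assms(1,2) n by (simp add: \<mu>_def)
  have "\<mu>\<^sup>2 = lW / (lH * n)" using assms(1,2) n by (simp add: \<mu>_def)
  hence lW: "lW = lH * n * \<mu>\<^sup>2" using assms(2) n by simp
  let ?z = "\<lambda>k i. W *v column (k, i) H + b"
  let ?L = "\<lambda>k i. (\<Sum>j\<in>UNIV. ?z k i $ j) - K * ?z k i $ k"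
  define S where "S = (\<Sum>k\<in>UNIV. \<Sum>i\<in>UNIV. ce_slack t (?z k i) k)"
  define X where "X = (\<Sum>k\<in>UNIV. \<Sum>i\<in>UNIV. (norm (column (k, i) H - \<mu> *\<^sub>R (row k W - wbar)))\<^sup>2)"
  have "(\<Sum>k\<in>UNIV. \<Sum>i\<in>UNIV. ce_loss (?z k i) k)
      = (\<Sum>k\<in>UNIV. \<Sum>i\<in>UNIV. gap_loss K t + ce_slack t (?z k i) k + q * ?L k i)"
    by (simp add: ce_slack_def K_def q_def)
  also have "\<dots> = K * n * gap_loss K t + S + q * (\<Sum>k\<in>UNIV. \<Sum>i\<in>(UNIV::'n set). ?L k i)"
    by (simp add: sum.distrib sum_distrib_left S_def K_def n_def)
  finally have CE: "(\<Sum>k\<in>UNIV. \<Sum>i\<in>UNIV. ce_loss (?z k i) k) = \<dots>" .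
  have Kw: "K * (wbar \<bullet> h) = (\<Sum>j\<in>UNIV. row j W \<bullet> h)" for h
    using K by (simp add: wbar_def inner_sum_left)
  have "(\<Sum>j\<in>UNIV. ?z k i $ j) = (\<Sum>j\<in>UNIV. row j W \<bullet> column (k, i) H) + (\<Sum>j\<in>UNIV. b $ j)"
    and "?z k i $ k = row k W \<bullet> column (k, i) H + b $ k" for k i
    by (simp_all only: vector_add_component matrix_vector_mult_eq_inner_row sum.distrib)
  hence L1: "?L k i = ((\<Sum>j\<in>UNIV. b $ j) - K * b $ k) - K * ((row k W - wbar) \<bullet> column (k, i) H)" for k i
    by (simp only: inner_diff_left right_diff_distrib distrib_left Kw)
  \<comment> \<open>AM-GM in exact form: the deficit is the square measuring how far the feature is
    from \<open>\<mu>\<close> times the centred row.\<close>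
  have L2: "(row k W - wbar) \<bullet> column (k, i) H =
      \<mu> / 2 * (norm (row k W - wbar))\<^sup>2 + 1 / (2 * \<mu>) * (norm (column (k, i) H))\<^sup>2
      - 1 / (2 * \<mu>) * (norm (column (k, i) H - \<mu> *\<^sub>R (row k W - wbar)))\<^sup>2" for k and i :: 'n
  proof -
    have "(norm (h - \<mu> *\<^sub>R v))\<^sup>2 = (norm h)\<^sup>2 - 2 * \<mu> * (v \<bullet> h) + \<mu>\<^sup>2 * (norm v)\<^sup>2" for h v :: "real ^ 'd"
      unfolding power2_norm_eq_inner
      by (simp add: inner_diff_left inner_diff_right inner_commute power2_eq_square algebra_simps)
    thus ?thesis using \<mu> by (simp add: diff_divide_distrib add_divide_distrib power2_eq_square)
  qed
  have "?L k i = ((\<Sum>j\<in>UNIV. b $ j) - K * b $ k) - K * (\<mu> / 2) * (norm (row k W - wbar))\<^sup>2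
      - K / (2 * \<mu>) * (norm (column (k, i) H))\<^sup>2
      + K / (2 * \<mu>) * (norm (column (k, i) H - \<mu> *\<^sub>R (row k W - wbar)))\<^sup>2" for k i
    unfolding L1 L2 by (simp add: distrib_left right_diff_distrib)
  hence "(\<Sum>k\<in>UNIV. \<Sum>i\<in>(UNIV::'n set). ?L k i)
      = (\<Sum>k\<in>UNIV. \<Sum>i\<in>(UNIV::'n set). (\<Sum>j\<in>UNIV. b $ j) - K * b $ k)
        - K * (\<mu> / 2) * (\<Sum>k\<in>UNIV. \<Sum>i\<in>(UNIV::'n set). (norm (row k W - wbar))\<^sup>2)
        - K / (2 * \<mu>) * (\<Sum>k\<in>UNIV. \<Sum>i\<in>UNIV. (norm (column (k, i) H))\<^sup>2) + K / (2 * \<mu>) * X"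
    by (simp only: sum.distrib sum_subtractf sum_distrib_left[symmetric] X_def)
  \<comment> \<open>Balance enters here: every class has the same number of samples, so the bias
    cancels.\<close>
  also have "(\<Sum>k\<in>UNIV. \<Sum>i\<in>(UNIV::'n set). (\<Sum>j\<in>UNIV. b $ j) - K * b $ k) = 0"
    by (simp add: sum_subtractf sum_distrib_left[symmetric] K_def)
  also have "(\<Sum>k\<in>UNIV. \<Sum>i\<in>UNIV. (norm (column (k, i) H))\<^sup>2) = (norm H)\<^sup>2"
    by (simp add: norm_matrix_columns sum.cartesian_product)
  also have "(\<Sum>k\<in>UNIV. \<Sum>i\<in>(UNIV::'n set). (norm (row k W - wbar))\<^sup>2)
      = n * ((norm W)\<^sup>2 - K * (norm wbar)\<^sup>2)"
    using sum_norm_centered[of "\<lambda>k. row k W"]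
    by (simp add: norm_matrix_rows wbar_def K_def n_def sum_distrib_left[symmetric])
  finally have L: "(\<Sum>k\<in>UNIV. \<Sum>i\<in>(UNIV::'n set). ?L k i) = 0 - K * (\<mu> / 2) * (n * ((norm W)\<^sup>2 - K * (norm wbar)\<^sup>2))
        - K / (2 * \<mu>) * (norm H)\<^sup>2 + K / (2 * \<mu>) * X" .
  \<comment> \<open>Pure arithmetic from here: \<open>G\<close> stands for the constant, and
    \<open>x\<close>, \<open>y\<close>, \<open>h\<close> for the squared norms of \<open>W\<close>,
    \<open>wbar\<close>, \<open>H\<close>.\<close>
  have "1 / (K * n) * (K * n * G + S + q * (0 - K * (\<mu> / 2) * (n * (x - K * y)) - K / (2 * \<mu>) * h + K / (2 * \<mu>) * X))
      = G + 1 / (K * n) * S - q * \<mu> / 2 * x + q * \<mu> * K / 2 * y - q / (2 * n * \<mu>) * h + q / (2 * n * \<mu>) * X"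
    for G x y h
  proof -
    have eqs: "1 / (K * n) * (K * n * G) = G" "1 / (K * n) * (q * (K * (\<mu> / 2) * (n * (x - K * y)))) = q * \<mu> / 2 * (x - K * y)"
      "1 / (K * n) * (q * (K / (2 * \<mu>) * h)) = q / (2 * n * \<mu>) * h"
      "1 / (K * n) * (q * (K / (2 * \<mu>) * X)) = q / (2 * n * \<mu>) * X"
      using K n \<mu> by simp_all
    have dist: "a * (u + S + q * (0 - y1 - y2 + y3)) = a * u + a * S - a * (q * y1) - a * (q * y2) + a * (q * y3)"
      for a u y1 y2 y3
      by (simp add: algebra_simps)
    show ?thesis unfolding dist eqs by (simp add: right_diff_distrib)
  qed
  moreover have "(1 - q / (n * lH * \<mu>)) * (lH * n * \<mu>\<^sup>2 / 2 * x + lH / 2 * h)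
      = lH * n * \<mu>\<^sup>2 / 2 * x + lH / 2 * h - q * \<mu> / 2 * x - q / (2 * n * \<mu>) * h" for x h
  proof -
    have "q / (n * lH * \<mu>) * (lH * n * \<mu>\<^sup>2 / 2 * x) = q * \<mu> / 2 * x"
      "q / (n * lH * \<mu>) * (lH / 2 * h) = q / (2 * n * \<mu>) * h"
      using assms(2) n \<mu> by (simp_all add: power2_eq_square)
    thus ?thesis by (simp only: left_diff_distrib distrib_left mult_1_left)
  qed
  ultimately show ?thesis
    unfolding ufm_objective_def CE L S_def[symmetric] X_def[symmetric] K_def[symmetric] n_def[symmetric]
    unfolding lW by simp
qed

section \<open>Attaining the constant\<close>

text \<open>Distinct coordinate vectors, one for each class, are centred at their mean and scaled by
  \<open>\<alpha>\<close>. The dimension bound supplies enough coordinates.\<close>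

lemma simplex_etf_exists:
  assumes "CARD('k::finite) \<le> CARD('d::finite)"
  shows "\<exists>w :: 'k \<Rightarrow> real ^ 'd. (\<Sum>k\<in>UNIV. w k) = 0 \<and>
           (\<forall>j k. w j \<bullet> w k = \<alpha>\<^sup>2 * ((if j = k then 1 else 0) - 1 / real CARD('k)))"
proof -
  obtain e :: "'k \<Rightarrow> 'd" where e: "inj e"
    using card_le_inj[of "UNIV :: 'k set" "UNIV :: 'd set"] assms by auto
  define a where "a k = (axis (e k) 1 :: real ^ 'd)" for k
  define m where "m = (1 / real CARD('k)) *\<^sub>R (\<Sum>k\<in>UNIV. a k)"
  have aa: "a j \<bullet> a k = (if j = k then 1 else 0)" for j k
    using e by (simp add: a_def inner_axis_axis inj_eq)
  have am: "a j \<bullet> m = 1 / real CARD('k)" for j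
    by (simp add: m_def inner_sum_right aa)
  have ma: "m \<bullet> a j = 1 / real CARD('k)" for j
    using am by (simp add: inner_commute)
  have mm: "m \<bullet> m = 1 / real CARD('k)"
    by (subst m_def) (simp add: inner_sum_left am)
  have "(\<Sum>k\<in>UNIV. \<alpha> *\<^sub>R (a k - m)) = 0"
    unfolding scaleR_sum_right[symmetric] m_def sum_centered by simp
  moreover have "(a j - m) \<bullet> (a k - m) = (if j = k then 1 else 0) - 1 / real CARD('k)" for j k
    by (simp add: inner_diff_left inner_diff_right aa am ma mm)
  hence "(\<alpha> *\<^sub>R (a j - m)) \<bullet> (\<alpha> *\<^sub>R (a k - m))
      = \<alpha>\<^sup>2 * ((if j = k then 1 else 0) - 1 / real CARD('k))" for j k
    by (simp only: inner_scaleR_left inner_scaleR_right power2_eq_square mult.assoc)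
  ultimately show ?thesis by (intro exI[of _ "\<lambda>k. \<alpha> *\<^sub>R (a k - m)"]) blast
qed

text \<open>At \<open>q = r\<close> the tangent bound is sharp on an ETF; when weight decay is too strong for this
  (\<open>r < 1 / K\<close>) the tangent at zero logits already does the job.\<close>

lemma gap_weight_attainable:
  assumes "r > 0" "K > 0"
  obtains t where "t \<ge> 0" "gap_weight K t \<le> r" "t = 0 \<or> gap_weight K t = r"
proof (cases "1 / K \<le> r")
  \<comment> \<open>Strong weight decay: \<open>gap_weight K 0 = 1 / K\<close> is already at most
    \<open>r\<close>.\<close>
  case True
  thus ?thesis by (intro that[of 0]) (auto simp: gap_weight_def)
next
  case False
  \<comment> \<open>Solving \<open>gap_weight K t = r\<close> gives
    \<open>exp t = 1 / r - K + 1\<close>; that this exceeds 1 makes \<open>t\<close>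
    nonnegative.\<close>
  hence "1 / r - K + 1 > 1" using assms by (simp add: field_simps)
  hence "exp (ln (1 / r - K + 1)) = 1 / r - K + 1" "ln (1 / r - K + 1) \<ge> 0" by simp_all
  thus ?thesis using assms by (intro that[of "ln (1 / r - K + 1)"]) (auto simp: gap_weight_def)
qed

text \<open>A simplex ETF with aligned features and zero bias makes every slack in
  \<open>ufm_objective_eq\<close> vanish.\<close>

lemma ufm_objective_attains_gap_loss:
  fixes lW lH lb t :: real
  assumes "CARD('k::finite) \<le> CARD('d::finite)" and "lW > 0" "lH > 0" "t \<ge> 0"
    and q: "t = 0 \<or> gap_weight CARD('k) t = CARD('n::finite) * lH * sqrt (lW / (lH * real CARD('n)))"
  shows "\<exists>(W :: real ^ 'd ^ 'k) (H :: real ^ ('k \<times> 'n) ^ 'd).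
           ufm_objective lW lH lb W H 0 = gap_loss CARD('k) t"
proof -
  define \<mu> where "\<mu> = sqrt (lW / (lH * real CARD('n)))"
  have n: "real CARD('n) > 0" using card_ge_1[where 'k='n] by simp
  have \<mu>: "\<mu> > 0" using assms n by (simp add: \<mu>_def)
  \<comment> \<open>The logits will be \<open>\<mu>\<close> times the Gram entries, so the squared
    scale \<open>t / \<mu>\<close> produces gaps equal to \<open>t\<close>.\<close>
  obtain w :: "'k \<Rightarrow> real ^ 'd" where w0: "(\<Sum>k\<in>UNIV. w k) = 0"
    and ww: "\<And>j k. w j \<bullet> w k = (sqrt (t / \<mu>))\<^sup>2 * ((if j = k then 1 else 0) - 1 / real CARD('k))"
    using simplex_etf_exists[OF assms(1)] by meson
  define W :: "real ^ 'd ^ 'k" where "W = (\<chi> k. w k)"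
  define H :: "real ^ ('k \<times> 'n) ^ 'd" where "H = (\<chi> l c. \<mu> * w (fst c) $ l)"
  have W: "row k W = w k" for k by (simp add: row_def W_def)
  have H: "column (k, i) H = \<mu> *\<^sub>R w k" for k i by (simp add: column_def H_def vec_eq_iff)
  have z: "(W *v column (k, i) H + 0) $ j = t * ((if j = k then 1 else 0) - 1 / real CARD('k))"
    for k i j
    using \<mu> \<open>t \<ge> 0\<close> by (simp add: matrix_vector_mult_eq_inner_row W H ww)
  have "ce_slack t (W *v column (k, i) H + 0) k = 0" for k i
    unfolding ce_slack_eq_0_iff z by (simp add: algebra_simps)
  moreover have "(1 - gap_weight CARD('k) t / (CARD('n) * lH * \<mu>))
      * (lW / 2 * (norm W)\<^sup>2 + lH / 2 * (norm H)\<^sup>2) = 0"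
  \<comment> \<open>For \<open>t = 0\<close> the ETF collapses to zero and the norms vanish;
    otherwise the coefficient does.\<close>
  proof (cases "t = 0")
    case True
    hence "w k = 0" for k using ww[of k k] by simp
    hence "W = 0" "H = 0" by (simp_all add: W_def H_def vec_eq_iff)
    thus ?thesis by simp
  next
    case False
    thus ?thesis using q n \<mu> assms(2,3) by (simp add: \<mu>_def)
  qed
  ultimately have "ufm_objective lW lH lb W H 0 = gap_loss CARD('k) t"
    unfolding ufm_objective_eq[OF assms(2,3), of lb W H 0 t] \<mu>_def[symmetric]
    by (simp add: W H w0)
  thus ?thesis by blast
qed

section \<open>Structure of the minimizers\<close>

text \<open>A squeeze: the attained value bounds the minimum above by \<open>gap_loss K t\<close>,
  while the identity writes it as that constant plus nonnegative terms. Hence each term is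
  zero.\<close>

lemma ufm_minimizer_structure:
  fixes lW lH lb :: real
    and W :: "real ^ 'd ^ 'k" and H :: "real ^ ('k::finite \<times> 'n::finite) ^ 'd" and b :: "real ^ 'k"
  assumes "CARD('k) \<le> CARD('d)" and "lW > 0" "lH > 0" "lb \<ge> 0"
    and global_min: "\<And>(W' :: real ^ 'd ^ 'k) (H' :: real ^ ('k \<times> 'n) ^ 'd) b'.
           ufm_objective lW lH lb W H b \<le> ufm_objective lW lH lb W' H' b'"
  obtains t where "\<And>k i. column (k, i) H = sqrt (lW / (lH * real CARD('n))) *\<^sub>R row k W"
    and "(\<Sum>k\<in>UNIV. row k W) = 0" and "lb = 0 \<or> b = 0"
    and "\<And>k i j. j \<noteq> k \<Longrightarrow> (W *v column (k, i) H + b) $ k - (W *v column (k, i) H + b) $ j = t"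
proof -
  define K n where "K = real CARD('k)" and "n = real CARD('n)"
  define \<mu> where "\<mu> = sqrt (lW / (lH * n))"
  have K: "K > 0" and n: "n > 0"
    using card_ge_1[where 'k='k] card_ge_1[where 'k='n] by (simp_all add: K_def n_def)
  have \<mu>: "\<mu> > 0" using assms n by (simp add: \<mu>_def)
  obtain t where t: "t \<ge> 0" "gap_weight K t \<le> n * lH * \<mu>" "t = 0 \<or> gap_weight K t = n * lH * \<mu>"
    using gap_weight_attainable[of "n * lH * \<mu>" K] n \<mu> K assms by auto
  obtain W' :: "real ^ 'd ^ 'k" and H' :: "real ^ ('k \<times> 'n) ^ 'd"
    where "ufm_objective lW lH lb W' H' 0 = gap_loss K t"
    using ufm_objective_attains_gap_loss[where 'k='k and 'd='d and 'n='n] assms(1-3) t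
    unfolding K_def n_def \<mu>_def by blast
  hence le: "ufm_objective lW lH lb W H b \<le> gap_loss K t" using global_min[of W' H' 0] by simp
  define q where "q = gap_weight K t"
  have q: "q > 0" using gap_weight_pos[where 'k='k] by (simp add: q_def K_def)
  define wbar where "wbar = (1 / K) *\<^sub>R (\<Sum>j\<in>UNIV. row j W)"
  \<comment> \<open>Indexing by pairs turns each double sum into one sum of nonnegative terms, whose
    vanishing passes to every summand.\<close>
  define s where "s c = ce_slack t (W *v column c H + b) (fst c)" for c
  define x where "x c = (norm (column c H - \<mu> *\<^sub>R (row (fst c) W - wbar)))\<^sup>2" for c
  have sum0: "(\<Sum>c\<in>UNIV. s c) \<ge> 0" "(\<Sum>c\<in>UNIV. x c) \<ge> 0"
    by (auto intro!: sum_nonneg simp: s_def x_def ce_slack_nonneg)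
  have eq: "ufm_objective lW lH lb W H b = gap_loss K t + 1 / (K * n) * (\<Sum>c\<in>UNIV. s c)
      + q / (2 * n * \<mu>) * (\<Sum>c\<in>UNIV. x c) + q * \<mu> * K / 2 * (norm wbar)\<^sup>2
      + (1 - q / (n * lH * \<mu>)) * (lW / 2 * (norm W)\<^sup>2 + lH / 2 * (norm H)\<^sup>2)
      + lb / 2 * (norm b)\<^sup>2"
    unfolding ufm_objective_eq[OF assms(2,3), of lb W H b t]
    by (simp add: sum.cartesian_product case_prod_unfold K_def n_def \<mu>_def q_def wbar_def s_def x_def)
  have nonneg: "1 / (K * n) * (\<Sum>c\<in>UNIV. s c) \<ge> 0" "q / (2 * n * \<mu>) * (\<Sum>c\<in>UNIV. x c) \<ge> 0"
    "q * \<mu> * K / 2 * (norm wbar)\<^sup>2 \<ge> 0" "lb / 2 * (norm b)\<^sup>2 \<ge> 0"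
    using sum0 K n \<mu> q assms(4) by simp_all
  have "q / (n * lH * \<mu>) \<le> 1" using t(2) n \<mu> assms(3) by (simp add: q_def)
  hence "(1 - q / (n * lH * \<mu>)) * (lW / 2 * (norm W)\<^sup>2 + lH / 2 * (norm H)\<^sup>2) \<ge> 0"
    using assms(2,3) by (intro mult_nonneg_nonneg add_nonneg_nonneg) auto
  hence "1 / (K * n) * (\<Sum>c\<in>UNIV. s c) = 0" "q / (2 * n * \<mu>) * (\<Sum>c\<in>UNIV. x c) = 0"
    "q * \<mu> * K / 2 * (norm wbar)\<^sup>2 = 0" "lb / 2 * (norm b)\<^sup>2 = 0"
    using nonneg le eq by linarith+
  hence zero: "(\<Sum>c\<in>UNIV. s c) = 0" "(\<Sum>c\<in>UNIV. x c) = 0" "wbar = 0" "lb = 0 \<or> b = 0"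
    using K n \<mu> q by simp_all
  have "s c \<ge> 0" "x c \<ge> 0" for c by (simp_all add: s_def x_def ce_slack_nonneg)
  hence "s c = 0" "x c = 0" for c
    using zero(1,2) sum_nonneg_eq_0_iff[of UNIV s] sum_nonneg_eq_0_iff[of UNIV x]
    by (cases c; simp)+
  hence "column (k, i) H = \<mu> *\<^sub>R row k W" "ce_slack t (W *v column (k, i) H + b) k = 0" for k i
    using zero(3) by (force simp: s_def x_def)+
  thus ?thesis
    using that[of t] zero(3,4) K unfolding ce_slack_eq_0_iff wbar_def \<mu>_def n_def by simp
qed

text \<open>The guard \<open>w \<noteq> 0\<close> sets aside the collapsed case
  \<open>W = 0\<close>, which strong weight decay forces and in which the rows cannot be
  normalised.\<close>

theorem theorem3p1:
  fixes lW lH lb :: real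
    and W :: "real ^ 'd ^ 'k" and H :: "real ^ ('k::finite \<times> 'n::finite) ^ 'd" and b :: "real ^ 'k"
  assumes "CARD('k) \<ge> 2"
    and "CARD('d) \<ge> CARD('k)"
    and "lW > 0" and "lH > 0" and "lb \<ge> 0"
    and global_min: "\<And>(W' :: real ^ 'd ^ 'k) (H' :: real ^ ('k::finite \<times> 'n::finite) ^ 'd) (b' :: real ^ 'k).
           ufm_objective lW lH lb W H b \<le> ufm_objective lW lH lb W' H' b'"
  shows "\<exists>w \<beta> :: real.
      (\<forall>k. norm (row k W) = w) \<and>
      b = (\<chi> k. \<beta>) \<and>
      (\<forall>k i. column (k, i) H = sqrt (lW / (lH * real CARD('n))) *\<^sub>R row k W) \<and>
      (\<forall>i. (1 / real CARD('k)) *\<^sub>R (\<Sum>j\<in>UNIV. column (j, i) H) = 0) \<and>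
      (\<beta> = 0 \<or> lb = 0) \<and>
      (w \<noteq> 0 \<longrightarrow>
        (\<forall>U :: real ^ 'd ^ 'd. transpose U ** U = mat 1 \<longrightarrow>
          (let M = (1 / w) *\<^sub>R (U ** transpose W) in
             transpose M ** M =
               (real CARD('k) / (real CARD('k) - 1)) *\<^sub>R
                 (mat 1 - (1 / real CARD('k)) *\<^sub>R (\<chi> i j. 1)))))"
proof -
  let ?K = "real CARD('k)"
  define \<mu> where "\<mu> = sqrt (lW / (lH * real CARD('n)))"
  have n: "real CARD('n) > 0" using card_ge_1[where 'k='n] by simp
  have \<mu>: "\<mu> > 0" using assms(3,4) n by (simp add: \<mu>_def)
  have K: "?K \<ge> 2" using assms(1) by simp
  obtain t where H: "\<And>k i. column (k, i) H = \<mu> *\<^sub>R row k W"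
    and W0: "(\<Sum>k\<in>UNIV. row k W) = 0" and lb: "lb = 0 \<or> b = 0"
    and gap: "\<And>k (i :: 'n) j. j \<noteq> k \<Longrightarrow>
      (W *v column (k, i) H + b) $ k - (W *v column (k, i) H + b) $ j = t"
    using ufm_minimizer_structure[OF assms(2-5) global_min] unfolding \<mu>_def by blast
  define G where "G j k = row j W \<bullet> row k W" for j k
  have G_sym: "G j k = G k j" for j k by (simp add: G_def inner_commute)
  \<comment> \<open>Including \<open>j = k\<close> allows summing over all \<open>j\<close>. The
    sample index \<open>undefined\<close> is arbitrary, because by \<open>H\<close> the columns of a
    class coincide.\<close>
  have gap': "\<mu> * G j k + b $ j = \<mu> * G k k + b $ k - (if j = k then 0 else t)" for j k
    using gap[of j k undefined] by (cases "j = k")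
      (simp_all add: H matrix_vector_mult_eq_inner_row G_def diff_eq_eq algebra_simps)
  \<comment> \<open>The mean of the bias. Summing \<open>gap'\<close> over \<open>j\<close> removes
    the Gram entries, as the rows are centred, and so determines the diagonal.\<close>
  define B where "B = (\<Sum>j\<in>UNIV. b $ j) / ?K"
  have "(\<Sum>j\<in>UNIV. \<mu> * G j k) = 0" for k
  proof -
    have "(\<Sum>j\<in>UNIV. \<mu> * G j k) = \<mu> * ((\<Sum>j\<in>UNIV. row j W) \<bullet> row k W)"
      by (simp only: G_def sum_distrib_left inner_sum_left)
    thus ?thesis by (simp add: W0)
  qed
  moreover have "(\<Sum>j\<in>UNIV. \<mu> * G j k + b $ j) = ?K * (\<mu> * G k k + b $ k - t) + t" for k
  proof -
    have "\<mu> * G j k + b $ j = \<mu> * G k k + b $ k - t + (if j = k then t else 0)" for j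
      using gap'[of j k] by (cases "j = k") simp_all
    hence "(\<Sum>j\<in>UNIV. \<mu> * G j k + b $ j)
        = (\<Sum>j\<in>UNIV. \<mu> * G k k + b $ k - t + (if j = k then t else 0))"
      by (rule sum.cong[OF refl])
    thus ?thesis by (simp add: sum.distrib)
  qed
  ultimately have "?K * B = ?K * (\<mu> * G k k + b $ k - t) + t" for k
    by (simp add: sum.distrib B_def)
  hence diag: "\<mu> * G k k = B + t - t / ?K - b $ k" for k
    using K by (simp add: field_simps)
  have off_diag: "\<mu> * G j k = B - t / ?K - b $ j" if "j \<noteq> k" for j k
    using gap'[of j k] diag[of k] that by simp
  \<comment> \<open>Off the diagonal \<open>G j k\<close> depends on \<open>j\<close> only through
    \<open>b $ j\<close>, so exchanging the indices equates the biases.\<close>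
  have "b $ j = b $ k" for j k
    using off_diag[of j k] off_diag[of k j] G_sym[of j k] by (cases "j = k") auto
  hence "b $ k = B" for k
    unfolding B_def using K sum.cong[of UNIV UNIV "\<lambda>j. b $ j" "\<lambda>_. b $ k"] by simp
  hence b: "b = (\<chi> k. B)" by (simp add: vec_eq_iff)
  have G: "G j k = t / \<mu> * ((if j = k then 1 else 0) - 1 / ?K)" for j k
    using diag[of k] off_diag[of j k] \<mu> by (auto simp: b field_simps)
  define w where "w = sqrt (t / \<mu> * (1 - 1 / ?K))"
  have w: "norm (row k W) = w" for k
    using G[of k k] by (simp add: norm_eq_sqrt_inner G_def w_def)
  hence w2: "w\<^sup>2 = t / \<mu> * (1 - 1 / ?K)"
    using G[of k k] power2_norm_eq_inner[of "row k W" for k] by (simp add: G_def)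
  have "transpose M ** M = (?K / (?K - 1)) *\<^sub>R (mat 1 - (1 / ?K) *\<^sub>R (\<chi> i j. 1))"
    if "w \<noteq> 0" "transpose U ** U = mat 1" and M: "M = (1 / w) *\<^sub>R (U ** transpose W)"
    for U :: "real ^ 'd ^ 'd" and M
  proof -
    \<comment> \<open>The orthogonal factor cancels, leaving the Gram matrix of the rows of
      \<open>W\<close>.\<close>
    have "transpose M ** M = (1 / w)\<^sup>2 *\<^sub>R (W ** (transpose U ** U) ** transpose W)"
      by (simp add: M transpose_scalar matrix_transpose_mul matrix_scalar_ac
          scalar_matrix_assoc[symmetric] power2_eq_square matrix_mul_assoc)
    also have "\<dots> = (1 / w)\<^sup>2 *\<^sub>R (W ** transpose W)" using that(2) by simp
    finally have "(transpose M ** M) $ j $ k = G j k / w\<^sup>2" for j k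
      by (simp add: matrix_matrix_mult_def transpose_def row_def inner_vec_def G_def power_divide)
    moreover have "t \<noteq> 0" using that(1) by (auto simp: w_def)
    hence "G j k / w\<^sup>2 = ?K / (?K - 1) * ((if j = k then 1 else 0) - 1 / ?K)" for j k
      unfolding w2 G using \<mu> K by (simp add: divide_simps)
    ultimately show ?thesis by (simp add: vec_eq_iff mat_def)
  qed
  moreover have "B = 0 \<or> lb = 0" using lb b by (auto simp: vec_eq_iff)
  ultimately show ?thesis
    using w b H W0 unfolding Let_def \<mu>_def[symmetric]
    by (intro exI[of _ w] exI[of _ B]) (simp add: scaleR_sum_right[symmetric])
qed

end
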